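(* Let $X \subset \mathbb{R}^n$ be an open set and let $\phi : X \to \mathbb{R}^m$ be a function. If $\phi$ has an R-FISCIDS representation, then $\phi$ also has a P-FISCIDS representation and, in particular, a Q-FISCIDS representation.
   Context: FISCIDS representations. Let $\phi : X \to \mathbb{R}^m$ with $X \subset \mathbb{R}^n$ open. Consider an $N$-dimensional system with fixed initial state $z_0 \in \mathbb{R}^N$ (independent of $\xi$) and constant input $\xi \in X$: $$\dot z(\tau) = F(z(\tau))\,\xi, \quad z(0) = z_0, \qquad y(\tau) = h(z(\tau)),$$ where $F : Z \to \mathbb{R}^{N\times n}$ and $h : Z \to \mathbb{R}^m$ are defined on an open set $Z \subset \mathbb{R}^N$ containing $z_0$. Let $z(\tau;\xi)$ and $y(\tau;\xi)$ denote its state trajectory (in $Z$) and output. If for every $\xi \in X$ the trajectory $z(\tau;\xi)$ is defined for all $\tau \in [0,1]$ and $y(1;\xi) = \phi(\xi)$, the system, also specified by the tuple $(F(z),h(z),z_0)$, is called a FISCIDS (fixed-initial-state constant-input dynamical system) representation of $\phi$. It is an R-FISCIDS (rational) representation if the entries of $F$ and $h$ are rational functions of $z$ (quotients of polynomials whose denominators do not vanish on $Z$); a P-FISCIDS (polynomial) representation if the entries of $F$ and $h$ are polynomials; and a Q-FISCIDS (quadratic) representation if the entries of $F$ are polynomials of degree at most two and the entries of $h$ are affine functions. The dimension $N$ and the set $Z$ may differ between different representations of the same $\phi$. *)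

theory Defs
  imports "HOL-Analysis.Analysis"
begin

text \<open>
  The dimension \<open>N\<close> of the state space is existentially quantified, so it cannot be a type
  parameter. States are points of \<^term>\<open>Euclidean_space N\<close>, i.e. functions \<open>z :: nat \<Rightarrow> real\<close> with
  \<open>z i = 0\<close> for \<open>i \<ge> N\<close>; only the coordinates \<open>i < N\<close> carry information.
\<close>

type_synonym state = "nat \<Rightarrow> real"

text \<open>\<open>A\<close> is a finite set of exponent vectors and \<open>c\<close> gives the coefficients.\<close>

definition poly_of_degree_le_on :: "nat \<Rightarrow> nat \<Rightarrow> state set \<Rightarrow> (state \<Rightarrow> real) \<Rightarrow> bool" where
  "poly_of_degree_le_on d N Z f \<longleftrightarrow>
     (\<exists>(A :: (nat \<Rightarrow> nat) set) (c :: (nat \<Rightarrow> nat) \<Rightarrow> real).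
        finite A \<and> (\<forall>\<alpha>\<in>A. (\<Sum>i<N. \<alpha> i) \<le> d) \<and>
        (\<forall>z\<in>Z. f z = (\<Sum>\<alpha>\<in>A. c \<alpha> * (\<Prod>i<N. z i ^ \<alpha> i))))"

definition polynomial_on :: "nat \<Rightarrow> state set \<Rightarrow> (state \<Rightarrow> real) \<Rightarrow> bool" where
  "polynomial_on N Z f \<longleftrightarrow> (\<exists>d. poly_of_degree_le_on d N Z f)"

definition rational_on :: "nat \<Rightarrow> state set \<Rightarrow> (state \<Rightarrow> real) \<Rightarrow> bool" where
  "rational_on N Z f \<longleftrightarrow>
     (\<exists>p q. polynomial_on N Z p \<and> polynomial_on N Z q \<and>
        (\<forall>z\<in>Z. q z \<noteq> 0 \<and> f z = p z / q z))"

definition affine_fun_on :: "nat \<Rightarrow> state set \<Rightarrow> (state \<Rightarrow> real) \<Rightarrow> bool" where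
  "affine_fun_on N Z f \<longleftrightarrow>
     (\<exists>(a :: nat \<Rightarrow> real) (b :: real). \<forall>z\<in>Z. f z = b + (\<Sum>i<N. a i * z i))"

text \<open>
  \<open>F z i\<close> is the \<open>i\<close>-th row of the \<open>N \<times> n\<close> matrix \<open>F(z)\<close>, so that \<open>(F(z) \<xi>)\<^sub>i = F z i \<bullet> \<xi>\<close>.
  At the end points of the time interval the derivative is one-sided.
\<close>

definition state_trajectory ::
    "nat \<Rightarrow> state set \<Rightarrow> (state \<Rightarrow> nat \<Rightarrow> real ^ 'n) \<Rightarrow> state \<Rightarrow> real ^ 'n \<Rightarrow> (real \<Rightarrow> state) \<Rightarrow> bool"
  where
  "state_trajectory N Z F z0 \<xi> z \<longleftrightarrow>
     z 0 = z0 \<and>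
     (\<forall>\<tau>\<in>{0..1}. z \<tau> \<in> Z \<and>
        (\<forall>i<N. ((\<lambda>t. z t i) has_real_derivative (F (z \<tau>) i \<bullet> \<xi>)) (at \<tau> within {0..1})))"

text \<open>
  For rational, in particular polynomial, \<open>F\<close> the right-hand side is locally Lipschitz, so the
  trajectory whose existence is required below is unique on \<open>[0,1]\<close>.
\<close>

definition FISCIDS ::
    "(real ^ 'n) set \<Rightarrow> (real ^ 'n \<Rightarrow> real ^ 'm) \<Rightarrow> nat \<Rightarrow> state set \<Rightarrow>
     (state \<Rightarrow> nat \<Rightarrow> real ^ 'n) \<Rightarrow> (state \<Rightarrow> real ^ 'm) \<Rightarrow> state \<Rightarrow> bool" where
  "FISCIDS X \<phi> N Z F h z0 \<longleftrightarrow>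
     openin (Euclidean_space N) Z \<and> z0 \<in> Z \<and>
     (\<forall>\<xi>\<in>X. \<exists>z. state_trajectory N Z F z0 \<xi> z \<and> h (z 1) = \<phi> \<xi>)"

definition R_FISCIDS ::
    "(real ^ 'n) set \<Rightarrow> (real ^ 'n \<Rightarrow> real ^ 'm) \<Rightarrow> nat \<Rightarrow> state set \<Rightarrow>
     (state \<Rightarrow> nat \<Rightarrow> real ^ 'n) \<Rightarrow> (state \<Rightarrow> real ^ 'm) \<Rightarrow> state \<Rightarrow> bool" where
  "R_FISCIDS X \<phi> N Z F h z0 \<longleftrightarrow>
     FISCIDS X \<phi> N Z F h z0 \<and>
     (\<forall>i<N. \<forall>j. rational_on N Z (\<lambda>z. F z i $ j)) \<and>
     (\<forall>k. rational_on N Z (\<lambda>z. h z $ k))"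

definition P_FISCIDS ::
    "(real ^ 'n) set \<Rightarrow> (real ^ 'n \<Rightarrow> real ^ 'm) \<Rightarrow> nat \<Rightarrow> state set \<Rightarrow>
     (state \<Rightarrow> nat \<Rightarrow> real ^ 'n) \<Rightarrow> (state \<Rightarrow> real ^ 'm) \<Rightarrow> state \<Rightarrow> bool" where
  "P_FISCIDS X \<phi> N Z F h z0 \<longleftrightarrow>
     FISCIDS X \<phi> N Z F h z0 \<and>
     (\<forall>i<N. \<forall>j. polynomial_on N Z (\<lambda>z. F z i $ j)) \<and>
     (\<forall>k. polynomial_on N Z (\<lambda>z. h z $ k))"

definition Q_FISCIDS ::
    "(real ^ 'n) set \<Rightarrow> (real ^ 'n \<Rightarrow> real ^ 'm) \<Rightarrow> nat \<Rightarrow> state set \<Rightarrow>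
     (state \<Rightarrow> nat \<Rightarrow> real ^ 'n) \<Rightarrow> (state \<Rightarrow> real ^ 'm) \<Rightarrow> state \<Rightarrow> bool" where
  "Q_FISCIDS X \<phi> N Z F h z0 \<longleftrightarrow>
     FISCIDS X \<phi> N Z F h z0 \<and>
     (\<forall>i<N. \<forall>j. poly_of_degree_le_on 2 N Z (\<lambda>z. F z i $ j)) \<and>
     (\<forall>k. affine_fun_on N Z (\<lambda>z. h z $ k))"

end

theory Submission
  imports Defs
begin

text \<open>
  Let \<open>B\<close> consist of the coordinate functions and the reciprocals of all denominators occurring
  in \<open>F\<close> and \<open>h\<close>. Along trajectories the derivative of every element of \<open>B\<close> is \<open>v \<bullet> \<xi>\<close> with
  \<open>v\<close> polynomial in the elements of \<open>B\<close>, since \<open>(1/q)' = - (1/q)\<^sup>2 q'\<close>. Choose \<open>D\<close> so large that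
  all these \<open>v\<close> and the output have degree at most \<open>D\<close>, and take as new states all products of
  at most \<open>D\<close> elements of \<open>B\<close>. The derivative of such a product has degree at most \<open>2 D\<close>,
  and every product of length at most \<open>2 D\<close> splits into two states; the output is linear in the
  new states.
\<close>

section \<open>Words in finitely many functions\<close>

text \<open>
  Monomials are represented by words rather than exponent vectors, so that a monomial
  of degree at most \<open>2 D\<close> is factored by \<^const>\<open>take\<close> and \<^const>\<open>drop\<close>.
\<close>

definition word_prod :: "('a \<Rightarrow> real) list \<Rightarrow> 'a \<Rightarrow> real" where
  "word_prod w z = (\<Prod>b\<leftarrow>w. b z)"

definition words :: "'b set \<Rightarrow> nat \<Rightarrow> 'b list set" where
  "words B D = {w. set w \<subseteq> B \<and> length w \<le> D}"

text \<open>Equality is required on \<open>Z\<close> only, and \<open>c\<close> is not unique: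
  permuted words, for instance, have the same value.\<close>

definition word_poly :: "'a set \<Rightarrow> ('a \<Rightarrow> real) set \<Rightarrow> nat \<Rightarrow> ('a \<Rightarrow> real) \<Rightarrow> bool" where
  "word_poly Z B D f \<longleftrightarrow> (\<exists>c. \<forall>z\<in>Z. f z = (\<Sum>w\<in>words B D. c w * word_prod w z))"

lemma word_prod_simps [simp]:
  "word_prod [] z = 1"
  "word_prod (b # w) z = b z * word_prod w z"
  "word_prod (v @ w) z = word_prod v z * word_prod w z"
  by (simp_all add: word_prod_def)

lemma finite_words: "finite B \<Longrightarrow> finite (words B D)"
  by (simp add: words_def finite_lists_length_le)

lemma words_mono: "D \<le> E \<Longrightarrow> words B D \<subseteq> words B E"
  by (auto simp: words_def)

lemma word_poly_cong:
  assumes "word_poly Z B D f" "\<And>z. z \<in> Z \<Longrightarrow> f z = g z"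
  shows "word_poly Z B D g"
  using assms by (auto simp: word_poly_def)

lemma word_poly_mono:
  assumes "finite B" "D \<le> E" "word_poly Z B D f"
  shows "word_poly Z B E f"
proof -
  obtain c where c: "\<And>z. z \<in> Z \<Longrightarrow> f z = (\<Sum>w\<in>words B D. c w * word_prod w z)"
    using assms(3) by (auto simp: word_poly_def)
  have "f z = (\<Sum>w\<in>words B E. (if w \<in> words B D then c w else 0) * word_prod w z)"
    if "z \<in> Z" for z
    unfolding c[OF that]
  proof (rule sum.mono_neutral_cong_left)
    show "finite (words B E)" by (rule finite_words[OF assms(1)])
    show "words B D \<subseteq> words B E" by (rule words_mono[OF assms(2)])
  qed simp_all
  then show ?thesis
    unfolding word_poly_def by (intro exI[of _ "\<lambda>w. if w \<in> words B D then c w else 0"] ballI)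
qed

lemma word_poly_word:
  assumes "finite B" "w \<in> words B D"
  shows "word_poly Z B D (word_prod w)"
proof -
  have "word_prod w z = (\<Sum>u\<in>words B D. (if u = w then 1 else 0) * word_prod u z)" for z
    using assms by (simp add: finite_words if_distrib[of "\<lambda>x. x * _"] cong: if_cong)
  then show ?thesis unfolding word_poly_def
    by (intro exI[of _ "\<lambda>u. if u = w then 1 else 0"]) simp
qed

lemma word_poly_add:
  assumes "word_poly Z B D f" "word_poly Z B D g"
  shows "word_poly Z B D (\<lambda>z. f z + g z)"
proof -
  obtain c d where "\<And>z. z \<in> Z \<Longrightarrow> f z = (\<Sum>w\<in>words B D. c w * word_prod w z)"
    "\<And>z. z \<in> Z \<Longrightarrow> g z = (\<Sum>w\<in>words B D. d w * word_prod w z)"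
    using assms by (auto simp: word_poly_def)
  then show ?thesis unfolding word_poly_def
    by (intro exI[of _ "\<lambda>w. c w + d w"]) (simp add: ring_distribs sum.distrib)
qed

lemma word_poly_scale:
  assumes "word_poly Z B D f"
  shows "word_poly Z B D (\<lambda>z. r * f z)"
proof -
  obtain c where "\<And>z. z \<in> Z \<Longrightarrow> f z = (\<Sum>w\<in>words B D. c w * word_prod w z)"
    using assms by (auto simp: word_poly_def)
  then show ?thesis unfolding word_poly_def
    by (intro exI[of _ "\<lambda>w. r * c w"]) (simp add: sum_distrib_left mult.assoc)
qed

lemma word_poly_const: "finite B \<Longrightarrow> word_poly Z B D (\<lambda>z. r)"
  using word_poly_scale[OF word_poly_word[of B "[]" D Z], of r] by (simp add: words_def)

lemma word_poly_sum:
  assumes "finite B" "\<And>i. i \<in> I \<Longrightarrow> word_poly Z B D (f i)"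
  shows "word_poly Z B D (\<lambda>z. \<Sum>i\<in>I. f i z)"
  using assms(2)
  by (induction I rule: infinite_finite_induct)
    (auto intro: word_poly_add simp: word_poly_const[OF assms(1)])

lemma word_poly_mult:
  assumes "finite B" "word_poly Z B D f" "word_poly Z B E g"
  shows "word_poly Z B (D + E) (\<lambda>z. f z * g z)"
proof -
  obtain c d where cd: "\<And>z. z \<in> Z \<Longrightarrow> f z = (\<Sum>w\<in>words B D. c w * word_prod w z)"
    "\<And>z. z \<in> Z \<Longrightarrow> g z = (\<Sum>w\<in>words B E. d w * word_prod w z)"
    using assms by (auto simp: word_poly_def)
  \<comment> \<open>Different pairs \<open>(u, w)\<close> may concatenate to the same word; closure
    under sums collects such terms without a formula for the coefficients.\<close>
  have "word_poly Z B (D + E)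
      (\<lambda>z. \<Sum>u\<in>words B D. \<Sum>w\<in>words B E. (c u * d w) * word_prod (u @ w) z)"
    by (intro word_poly_sum word_poly_scale word_poly_word assms(1)) (auto simp: words_def)
  then show ?thesis
    by (rule word_poly_cong) (simp add: cd sum_product algebra_simps)
qed

lemma word_poly_generator: "finite B \<Longrightarrow> b \<in> B \<Longrightarrow> word_poly Z B 1 b"
  using word_poly_word[of B "[b]" 1 Z] by (simp add: words_def word_prod_def[abs_def])

text \<open>A word of length at most \<open>2 * D\<close> has at most \<open>D\<close> letters left
  after \<open>drop D\<close>, so both factors lie in \<open>words B D\<close>. For a word of length
  at most \<open>D\<close> the second factor is the empty word, with value 1.\<close>

lemma word_poly_split:
  assumes "word_poly Z B (2 * D) f"
  shows "\<exists>c. \<forall>z\<in>Z.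
    f z = (\<Sum>w\<in>words B (2 * D). c w * (word_prod (take D w) z * word_prod (drop D w) z))"
proof -
  have "word_prod (take D w) z * word_prod (drop D w) z = word_prod w z"
    for w :: "('a \<Rightarrow> real) list" and z
    by (metis append_take_drop_id word_prod_simps(3))
  then show ?thesis using assms by (simp add: word_poly_def)
qed

section \<open>Derivatives along trajectories\<close>

text \<open>For differentiable \<open>f\<close> the natural \<open>v\<close> is the gradient of
  \<open>f\<close> times \<open>F\<close>. Stating it along trajectories avoids partial derivatives
  on the state space; one \<open>v\<close> serves all inputs \<open>\<xi>\<close>.\<close>

definition has_lie_derivative ::
    "nat \<Rightarrow> state set \<Rightarrow> (state \<Rightarrow> nat \<Rightarrow> real ^ 'n) \<Rightarrow> state \<Rightarrow>
     (state \<Rightarrow> real) \<Rightarrow> (state \<Rightarrow> real ^ 'n) \<Rightarrow> bool" where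
  "has_lie_derivative N Z F z0 f v \<longleftrightarrow>
     (\<forall>\<xi> z. \<forall>\<tau>\<in>{0..1}. state_trajectory N Z F z0 \<xi> z \<longrightarrow>
        ((\<lambda>t. f (z t)) has_real_derivative (v (z \<tau>) \<bullet> \<xi>)) (at \<tau> within {0..1}))"

lemma has_lie_derivative_cong:
  assumes "has_lie_derivative N Z F z0 f v" "\<And>z. z \<in> Z \<Longrightarrow> f z = g z"
  shows "has_lie_derivative N Z F z0 g v"
  unfolding has_lie_derivative_def
proof (intro allI ballI impI)
  fix \<xi> z and \<tau> :: real
  assume \<tau>: "\<tau> \<in> {0..1}" and z: "state_trajectory N Z F z0 \<xi> z"
  have "((\<lambda>t. f (z t)) has_real_derivative (v (z \<tau>) \<bullet> \<xi>)) (at \<tau> within {0..1})"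
    using assms(1) \<tau> z by (simp add: has_lie_derivative_def)
  then show "((\<lambda>t. g (z t)) has_real_derivative (v (z \<tau>) \<bullet> \<xi>)) (at \<tau> within {0..1})"
    \<comment> \<open>The derivative within \<open>{0..1}\<close> sees only times at which the
      trajectory lies in \<open>Z\<close>, where \<open>f\<close> and \<open>g\<close>
      agree.\<close>
    by (rule has_field_derivative_transform_within[OF _ zero_less_one \<tau>])
      (use assms(2) z in \<open>auto simp: state_trajectory_def\<close>)
qed

lemma has_lie_derivative_const: "has_lie_derivative N Z F z0 (\<lambda>z. r) (\<lambda>z. 0)"
  by (simp add: has_lie_derivative_def)

lemma has_lie_derivative_coord: "i < N \<Longrightarrow> has_lie_derivative N Z F z0 (\<lambda>z. z i) (\<lambda>z. F z i)"
  by (simp add: has_lie_derivative_def state_trajectory_def)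

lemma has_lie_derivative_add:
  assumes "has_lie_derivative N Z F z0 f u" "has_lie_derivative N Z F z0 g v"
  shows "has_lie_derivative N Z F z0 (\<lambda>z. f z + g z) (\<lambda>z. u z + v z)"
  using assms unfolding has_lie_derivative_def by (auto intro!: DERIV_add simp: inner_add_left)

lemma has_lie_derivative_mult:
  assumes "has_lie_derivative N Z F z0 f u" "has_lie_derivative N Z F z0 g v"
  shows "has_lie_derivative N Z F z0 (\<lambda>z. f z * g z) (\<lambda>z. g z *\<^sub>R u z + f z *\<^sub>R v z)"
  using assms unfolding has_lie_derivative_def
  by (auto intro!: derivative_eq_intros simp: inner_add_left)

text \<open>The quotient rule is written with factors \<open>1 / f\<close> instead of a division by
  the square of \<open>f\<close>, so that it reads as a polynomial once \<open>1 / f\<close> is a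
  generator.\<close>

lemma has_lie_derivative_inverse:
  assumes "has_lie_derivative N Z F z0 f u" "\<And>z. z \<in> Z \<Longrightarrow> f z \<noteq> 0"
  shows "has_lie_derivative N Z F z0 (\<lambda>z. 1 / f z) (\<lambda>z. (- (1 / f z * (1 / f z))) *\<^sub>R u z)"
  using assms unfolding has_lie_derivative_def
  by (auto intro!: derivative_eq_intros simp: state_trajectory_def divide_simps)

text \<open>The product rule brings \<open>f\<close> and \<open>g\<close> themselves into the
  derivative of their product, so closure under products needs the function as well as its
  derivative to be polynomial in \<open>B\<close>. The degree may vary with \<open>j\<close>; a
  common bound is chosen later.\<close>

definition poly_lie_derivative ::
    "nat \<Rightarrow> state set \<Rightarrow> (state \<Rightarrow> nat \<Rightarrow> real ^ 'n) \<Rightarrow> state \<Rightarrow> (state \<Rightarrow> real) set \<Rightarrow>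
     (state \<Rightarrow> real) \<Rightarrow> bool" where
  "poly_lie_derivative N Z F z0 B f \<longleftrightarrow>
     (\<exists>D. word_poly Z B D f) \<and>
     (\<exists>v. (\<forall>j. \<exists>D. word_poly Z B D (\<lambda>z. v z $ j)) \<and> has_lie_derivative N Z F z0 f v)"

lemma ex_word_poly_add:
  assumes "finite B" "\<exists>D. word_poly Z B D f" "\<exists>D. word_poly Z B D g"
  shows "\<exists>D. word_poly Z B D (\<lambda>z. f z + g z)"
proof -
  obtain D E where "word_poly Z B D f" "word_poly Z B E g"
    using assms by blast
  then have "word_poly Z B (max D E) f" "word_poly Z B (max D E) g"
    using assms(1) by (auto intro: word_poly_mono[rotated 2])
  then show ?thesis using word_poly_add by blast
qed

lemma ex_word_poly_mult:
  assumes "finite B" "\<exists>D. word_poly Z B D f" "\<exists>D. word_poly Z B D g"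
  shows "\<exists>D. word_poly Z B D (\<lambda>z. f z * g z)"
proof -
  obtain D E where "word_poly Z B D f" "word_poly Z B E g"
    using assms by blast
  then have "word_poly Z B (D + E) (\<lambda>z. f z * g z)"
    by (rule word_poly_mult[OF assms(1)])
  then show ?thesis by blast
qed

lemma poly_lie_derivative_cong:
  assumes "poly_lie_derivative N Z F z0 B f" "\<And>z. z \<in> Z \<Longrightarrow> f z = g z"
  shows "poly_lie_derivative N Z F z0 B g"
proof -
  obtain D v where D: "word_poly Z B D f" and v: "\<forall>j. \<exists>D. word_poly Z B D (\<lambda>z. v z $ j)"
    and f: "has_lie_derivative N Z F z0 f v"
    using assms(1) unfolding poly_lie_derivative_def by blast
  from D assms(2) have "word_poly Z B D g" by (rule word_poly_cong)
  moreover from f assms(2) have "has_lie_derivative N Z F z0 g v"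
    by (rule has_lie_derivative_cong)
  ultimately show ?thesis using v unfolding poly_lie_derivative_def by blast
qed

lemma poly_lie_derivative_const:
  assumes "finite B"
  shows "poly_lie_derivative N Z F z0 B (\<lambda>z. r)"
  unfolding poly_lie_derivative_def
  by (intro conjI exI[of _ "\<lambda>_. 0"]) (auto simp: word_poly_const[OF assms] has_lie_derivative_const)

lemma poly_lie_derivative_add:
  assumes "finite B" "poly_lie_derivative N Z F z0 B f" "poly_lie_derivative N Z F z0 B g"
  shows "poly_lie_derivative N Z F z0 B (\<lambda>z. f z + g z)"
proof -
  obtain u v where
    "\<forall>j. \<exists>D. word_poly Z B D (\<lambda>z. u z $ j)" "has_lie_derivative N Z F z0 f u"
    "\<forall>j. \<exists>D. word_poly Z B D (\<lambda>z. v z $ j)" "has_lie_derivative N Z F z0 g v"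
    using assms unfolding poly_lie_derivative_def by blast
  then show ?thesis
    using assms unfolding poly_lie_derivative_def
    by (intro conjI exI[of _ "\<lambda>z. u z + v z"] has_lie_derivative_add)
      (auto intro!: ex_word_poly_add)
qed

lemma poly_lie_derivative_mult:
  assumes "finite B" "poly_lie_derivative N Z F z0 B f" "poly_lie_derivative N Z F z0 B g"
  shows "poly_lie_derivative N Z F z0 B (\<lambda>z. f z * g z)"
proof -
  obtain u v where
    "\<forall>j. \<exists>D. word_poly Z B D (\<lambda>z. u z $ j)" "has_lie_derivative N Z F z0 f u"
    "\<forall>j. \<exists>D. word_poly Z B D (\<lambda>z. v z $ j)" "has_lie_derivative N Z F z0 g v"
    using assms unfolding poly_lie_derivative_def by blast
  then show ?thesis
    using assms unfolding poly_lie_derivative_def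
    by (intro conjI exI[of _ "\<lambda>z. g z *\<^sub>R u z + f z *\<^sub>R v z"] has_lie_derivative_mult)
      (auto intro!: ex_word_poly_add ex_word_poly_mult)
qed

lemma poly_lie_derivative_sum:
  assumes "finite B" "\<And>i. i \<in> I \<Longrightarrow> poly_lie_derivative N Z F z0 B (f i)"
  shows "poly_lie_derivative N Z F z0 B (\<lambda>z. \<Sum>i\<in>I. f i z)"
  using assms(2)
  by (induction I rule: infinite_finite_induct)
    (auto intro: poly_lie_derivative_add assms(1) poly_lie_derivative_const)

lemma poly_lie_derivative_prod:
  assumes "finite B" "\<And>i. i \<in> I \<Longrightarrow> poly_lie_derivative N Z F z0 B (f i)"
  shows "poly_lie_derivative N Z F z0 B (\<lambda>z. \<Prod>i\<in>I. f i z)"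
  using assms(2)
  by (induction I rule: infinite_finite_induct)
    (auto intro: poly_lie_derivative_mult assms(1) poly_lie_derivative_const)

lemma poly_lie_derivative_power:
  assumes "finite B" "poly_lie_derivative N Z F z0 B f"
  shows "poly_lie_derivative N Z F z0 B (\<lambda>z. f z ^ k)"
  by (induction k) (auto intro: poly_lie_derivative_mult assms poly_lie_derivative_const)

text \<open>Coordinates and constants generate all polynomials by sums, products and powers, so the
  closure rules replace a formula for the gradient.\<close>

lemma poly_lie_derivative_polynomial:
  assumes "finite B" "\<And>i. i < N \<Longrightarrow> poly_lie_derivative N Z F z0 B (\<lambda>z. z i)"
    and "polynomial_on N Z f"
  shows "poly_lie_derivative N Z F z0 B f"
proof -
  obtain A :: "(nat \<Rightarrow> nat) set" and c where
    f: "\<forall>z\<in>Z. f z = (\<Sum>\<alpha>\<in>A. c \<alpha> * (\<Prod>i<N. z i ^ \<alpha> i))"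
    using assms(3) unfolding polynomial_on_def poly_of_degree_le_on_def by blast
  have "poly_lie_derivative N Z F z0 B (\<lambda>z. \<Sum>\<alpha>\<in>A. c \<alpha> * (\<Prod>i<N. z i ^ \<alpha> i))"
    using assms(1,2)
    by (intro poly_lie_derivative_sum poly_lie_derivative_mult poly_lie_derivative_prod
        poly_lie_derivative_power poly_lie_derivative_const) auto
  then show ?thesis by (rule poly_lie_derivative_cong) (simp add: f)
qed

text \<open>
  For \<open>F = 0\<close> every coordinate trivially has a polynomial Lie derivative, so the
  closure properties already proved apply.
\<close>

lemma ex_word_poly_polynomial:
  assumes "finite B" "\<And>i. i < N \<Longrightarrow> (\<lambda>z. z i) \<in> B" "polynomial_on N Z f"
  shows "\<exists>D. word_poly Z B D f"
proof -
  let ?F = "\<lambda>_ _. 0 :: real ^ 1"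
  have "poly_lie_derivative N Z ?F undefined B (\<lambda>z. z i)" if "i < N" for i
    unfolding poly_lie_derivative_def
    using word_poly_generator[OF assms(1) assms(2)[OF that], of Z]
      has_lie_derivative_coord[OF that, of Z ?F undefined]
    by (intro conjI exI[of _ "\<lambda>_. 0"] exI[of _ 1]) (auto simp: word_poly_const[OF assms(1)])
  then have "poly_lie_derivative N Z ?F undefined B f"
    by (rule poly_lie_derivative_polynomial[OF assms(1) _ assms(3)])
  then show ?thesis by (simp add: poly_lie_derivative_def)
qed

text \<open>The reciprocal has degree 1 as a generator, and its derivative is, up to sign, two
  copies of it times the polynomial \<open>u\<close>.\<close>

lemma poly_lie_derivative_inverse:
  assumes "finite B" "poly_lie_derivative N Z F z0 B f" "(\<lambda>z. 1 / f z) \<in> B"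
    and "\<And>z. z \<in> Z \<Longrightarrow> f z \<noteq> 0"
  shows "poly_lie_derivative N Z F z0 B (\<lambda>z. 1 / f z)"
proof -
  obtain u where u: "\<And>j. \<exists>D. word_poly Z B D (\<lambda>z. u z $ j)" "has_lie_derivative N Z F z0 f u"
    using assms unfolding poly_lie_derivative_def by blast
  have g: "\<exists>D. word_poly Z B D (\<lambda>z. 1 / f z)"
    using word_poly_generator assms by blast
  have "\<exists>D. word_poly Z B D (\<lambda>z. (- 1) * ((1 / f z) * (1 / f z) * u z $ j))" for j
    using word_poly_scale ex_word_poly_mult[OF assms(1) ex_word_poly_mult[OF assms(1) g g] u(1)]
    by blast
  then show ?thesis
    unfolding poly_lie_derivative_def
    using g has_lie_derivative_inverse[OF u(2) assms(4)]
    by (intro conjI exI[of _ "\<lambda>z. (- (1 / f z * (1 / f z))) *\<^sub>R u z"]) auto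
qed

text \<open>
  A product of \<open>k\<close> generators has a derivative of degree at most \<open>D + k - 1\<close>; the weaker
  bound \<open>D + k\<close> avoids truncated subtraction and is still \<open>\<le> 2 D\<close> for \<open>k \<le> D\<close>.
\<close>

lemma has_lie_derivative_word:
  assumes "finite B"
    and "\<And>b. b \<in> B \<Longrightarrow> has_lie_derivative N Z F z0 b (v b)"
    and "\<And>b j. b \<in> B \<Longrightarrow> word_poly Z B D (\<lambda>z. v b z $ j)"
    and "set w \<subseteq> B"
  shows "\<exists>u. (\<forall>j. word_poly Z B (D + length w) (\<lambda>z. u z $ j)) \<and>
             has_lie_derivative N Z F z0 (word_prod w) u"
  using assms(4)
proof (induction w)
  case Nil
  have "has_lie_derivative N Z F z0 (word_prod []) (\<lambda>z. 0)"
    using has_lie_derivative_const by (rule has_lie_derivative_cong) simp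
  then show ?case
    by (intro exI[of _ "\<lambda>z. 0"] conjI allI) (simp_all only: zero_index word_poly_const assms(1))
next
  case (Cons b w)
  then obtain u where u: "\<And>j. word_poly Z B (D + length w) (\<lambda>z. u z $ j)"
    "has_lie_derivative N Z F z0 (word_prod w) u" by auto
  have b: "b \<in> B" and w: "word_poly Z B (length w) (word_prod w)"
    using Cons.prems word_poly_word[OF assms(1), of w] by (auto simp: words_def)
  have "has_lie_derivative N Z F z0 (word_prod (b # w)) (\<lambda>z. word_prod w z *\<^sub>R v b z + b z *\<^sub>R u z)"
    using has_lie_derivative_mult[OF assms(2)[OF b] u(2)] by (rule has_lie_derivative_cong) simp
  moreover have "word_poly Z B (D + length (b # w))
      (\<lambda>z. (word_prod w z *\<^sub>R v b z + b z *\<^sub>R u z) $ j)" for j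
  proof -
    \<comment> \<open>The first summand has degree at most \<open>length w + D\<close>; the second,
      at most \<open>1 + (D + length w)\<close>, meets the bound exactly.\<close>
    have "word_poly Z B (D + length (b # w)) (\<lambda>z. word_prod w z * v b z $ j)"
      by (rule word_poly_mono[OF assms(1) _ word_poly_mult[OF assms(1) w assms(3)[OF b]]]) simp
    moreover have "word_poly Z B (D + length (b # w)) (\<lambda>z. b z * u z $ j)"
      by (rule word_poly_mono[OF assms(1) _
            word_poly_mult[OF assms(1) word_poly_generator[OF assms(1) b] u(1)]]) simp
    ultimately show ?thesis by (simp add: word_poly_add)
  qed
  ultimately show ?case
    by (intro exI[of _ "\<lambda>z. word_prod w z *\<^sub>R v b z + b z *\<^sub>R u z"] conjI allI)
qed

section \<open>Polynomials in the new coordinates\<close>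

lemma poly_of_degree_le_on_monomial:
  assumes "(\<Sum>i<N. \<alpha> i) \<le> d"
  shows "poly_of_degree_le_on d N Z (\<lambda>z. c * (\<Prod>i<N. z i ^ \<alpha> i))"
  unfolding poly_of_degree_le_on_def
  using assms by (intro exI[of _ "{\<alpha>}"] exI[of _ "\<lambda>_. c"]) simp

lemma poly_of_degree_le_on_add:
  assumes "poly_of_degree_le_on d N Z f" "poly_of_degree_le_on d N Z g"
  shows "poly_of_degree_le_on d N Z (\<lambda>z. f z + g z)"
proof -
  let ?m = "\<lambda>\<alpha> z. \<Prod>i<N. z i ^ \<alpha> i :: real"
  obtain A a where A: "finite A" "\<forall>\<alpha>\<in>A. (\<Sum>i<N. \<alpha> i) \<le> d" "\<forall>z\<in>Z. f z = (\<Sum>\<alpha>\<in>A. a \<alpha> * ?m \<alpha> z)"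
    using assms(1) unfolding poly_of_degree_le_on_def by blast
  obtain B b where B: "finite B" "\<forall>\<alpha>\<in>B. (\<Sum>i<N. \<alpha> i) \<le> d" "\<forall>z\<in>Z. g z = (\<Sum>\<alpha>\<in>B. b \<alpha> * ?m \<alpha> z)"
    using assms(2) unfolding poly_of_degree_le_on_def by blast
  \<comment> \<open>The exponent sets may overlap, so both coefficient families are extended by zero
    to the union and added.\<close>
  let ?c = "\<lambda>\<alpha>. (if \<alpha> \<in> A then a \<alpha> else 0) + (if \<alpha> \<in> B then b \<alpha> else 0)"
  have "f z + g z = (\<Sum>\<alpha>\<in>A \<union> B. ?c \<alpha> * ?m \<alpha> z)" if "z \<in> Z" for z
  proof -
    have "(\<Sum>\<alpha>\<in>A. a \<alpha> * ?m \<alpha> z) = (\<Sum>\<alpha>\<in>A \<union> B. (if \<alpha> \<in> A then a \<alpha> else 0) * ?m \<alpha> z)"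
      using A(1) B(1) by (intro sum.mono_neutral_cong_left) auto
    moreover have "(\<Sum>\<alpha>\<in>B. b \<alpha> * ?m \<alpha> z) = (\<Sum>\<alpha>\<in>A \<union> B. (if \<alpha> \<in> B then b \<alpha> else 0) * ?m \<alpha> z)"
      using A(1) B(1) by (intro sum.mono_neutral_cong_left) auto
    ultimately show ?thesis using A(3) B(3) that by (simp add: distrib_right sum.distrib)
  qed
  then show ?thesis
    unfolding poly_of_degree_le_on_def using A(1,2) B(1,2)
    by (intro exI[of _ "A \<union> B"] exI[of _ ?c]) auto
qed

lemma poly_of_degree_le_on_sum:
  assumes "\<And>i. i \<in> I \<Longrightarrow> poly_of_degree_le_on d N Z (f i)"
  shows "poly_of_degree_le_on d N Z (\<lambda>z. \<Sum>i\<in>I. f i z)"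
proof -
  have "poly_of_degree_le_on d N Z (\<lambda>z. 0)"
    unfolding poly_of_degree_le_on_def by (intro exI[of _ "{}"]) simp
  with assms show ?thesis
    by (induction I rule: infinite_finite_induct) (auto intro: poly_of_degree_le_on_add)
qed

lemma poly_of_degree_le_on_quadratic:
  assumes "i < N" "j < N"
  shows "poly_of_degree_le_on 2 N Z (\<lambda>z. c * (z i * z j))"
proof -
  \<comment> \<open>A sum of two indicators covers the square as well: for \<open>i = j\<close> the
    exponent is 2.\<close>
  let ?\<alpha> = "\<lambda>k. of_bool (k = i) + of_bool (k = j) :: nat"
  have single: "(\<Prod>k<N. z k ^ of_bool (k = i)) = (z i :: real)" if "i < N" for i and z :: state
    using that by (simp add: of_bool_def if_distrib[of "\<lambda>n. _ ^ n"] cong: if_cong)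
  have "(\<Sum>k<N. ?\<alpha> k) \<le> 2"
    using assms by (simp add: sum.distrib of_bool_def)
  then have "poly_of_degree_le_on 2 N Z (\<lambda>z. c * (\<Prod>k<N. z k ^ ?\<alpha> k))"
    by (rule poly_of_degree_le_on_monomial)
  then show ?thesis
    using assms by (simp add: power_add prod.distrib single)
qed

lemma polynomial_on_affine:
  assumes "affine_fun_on N Z f"
  shows "polynomial_on N Z f"
proof -
  obtain a b where f: "\<forall>z\<in>Z. f z = b + (\<Sum>i<N. a i * z i)"
    using assms unfolding affine_fun_on_def by blast
  have "poly_of_degree_le_on 1 N Z (\<lambda>z. b * (\<Prod>k<N. z k ^ 0))"
    by (rule poly_of_degree_le_on_monomial) simp
  moreover have "poly_of_degree_le_on 1 N Z (\<lambda>z. \<Sum>i<N. a i * (\<Prod>k<N. z k ^ of_bool (k = i)))"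
    by (intro poly_of_degree_le_on_sum poly_of_degree_le_on_monomial)
      (simp add: of_bool_def)
  ultimately have "poly_of_degree_le_on 1 N Z
      (\<lambda>z. b * (\<Prod>k<N. z k ^ 0) + (\<Sum>i<N. a i * (\<Prod>k<N. z k ^ of_bool (k = i))))"
    by (rule poly_of_degree_le_on_add)
  moreover have "(\<Sum>i<N. a i * (\<Prod>k<N. z k ^ of_bool (k = i))) = (\<Sum>i<N. a i * z i)" for z :: state
    by (intro sum.cong)
      (simp_all add: of_bool_def if_distrib[of "\<lambda>n. _ ^ n"] cong: if_cong)
  ultimately have "poly_of_degree_le_on 1 N Z (\<lambda>z. b + (\<Sum>i<N. a i * z i))" by simp
  then show ?thesis
    using f unfolding polynomial_on_def poly_of_degree_le_on_def by simp blast
qed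

text \<open>The same data serve, so both conclusions of the theorem come from one
  construction.\<close>

lemma Q_FISCIDS_imp_P_FISCIDS: "Q_FISCIDS X \<phi> N Z F h z0 \<Longrightarrow> P_FISCIDS X \<phi> N Z F h z0"
  unfolding Q_FISCIDS_def P_FISCIDS_def
  using polynomial_on_affine polynomial_on_def by blast

section \<open>The quadratic representation\<close>

text \<open>\<open>D\<close> bounds the length of the words used as states, the degree of the
  generators' derivatives and that of the output. Hence derivatives of states have degree at most
  \<open>2 * D\<close>, and the output is a linear combination of states.\<close>

lemma Q_FISCIDS_of_words:
  fixes F :: "state \<Rightarrow> nat \<Rightarrow> real ^ 'n" and h :: "state \<Rightarrow> real ^ 'm"
  assumes rep: "FISCIDS X \<phi> N Z F h z0" and fin: "finite B"
    and gen: "\<And>b. b \<in> B \<Longrightarrow> has_lie_derivative N Z F z0 b (v b)"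
    and v: "\<And>b j. b \<in> B \<Longrightarrow> word_poly Z B D (\<lambda>z. v b z $ j)"
    and h: "\<And>k. word_poly Z B D (\<lambda>z. h z $ k)"
  shows "\<exists>M Y G g y0. Q_FISCIDS X \<phi> M Y G g y0"
proof -
  let ?W = "words B D"
  define M where "M = card ?W"
  obtain e where e: "bij_betw e {..<M} ?W"
    using ex_bij_betw_nat_finite[OF finite_words[OF fin]] by (auto simp: M_def atLeast0LessThan)
  define ix where "ix = inv_into {..<M} e"
  have ix: "ix w < M" "e (ix w) = w" if "w \<in> ?W" for w
    using that e bij_betw_imp_surj_on[OF e] inv_into_into[of w e "{..<M}"]
      f_inv_into_f[of w e "{..<M}"] by (auto simp: ix_def)
  have eW: "e a \<in> ?W" if "a < M" for a
    using that e by (auto simp: bij_betw_def)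
  have "\<exists>u. (\<forall>j. word_poly Z B (2 * D) (\<lambda>z. u z $ j)) \<and> has_lie_derivative N Z F z0 (word_prod w) u"
    if "w \<in> ?W" for w
  proof -
    have "set w \<subseteq> B" "D + length w \<le> 2 * D"
      using that by (auto simp: words_def)
    then show ?thesis
      using has_lie_derivative_word[of B N Z F z0 v D w, OF fin gen v] word_poly_mono[OF fin]
      by blast
  qed
  then obtain u where u: "\<And>w j. w \<in> ?W \<Longrightarrow> word_poly Z B (2 * D) (\<lambda>z. u w z $ j)"
    "\<And>w. w \<in> ?W \<Longrightarrow> has_lie_derivative N Z F z0 (word_prod w) (u w)" by metis
  \<comment> \<open>Naming the predicate keeps the formula opaque while \<open>c\<close> is chosen
    for all \<open>w\<close> and \<open>j\<close> at once.\<close>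
  define split_coeffs where "split_coeffs w j c \<longleftrightarrow> (\<forall>z\<in>Z. u w z $ j =
      (\<Sum>x\<in>words B (2 * D). c x * (word_prod (take D x) z * word_prod (drop D x) z)))" for w j c
  have "\<exists>c. split_coeffs w j c" if "w \<in> ?W" for w j
    unfolding split_coeffs_def by (rule word_poly_split[OF u(1)[OF that]])
  then obtain c where "\<And>w j. w \<in> ?W \<Longrightarrow> split_coeffs w j (c w j)" by metis
  then have c: "u w z $ j =
      (\<Sum>x\<in>words B (2 * D). c w j x * (word_prod (take D x) z * word_prod (drop D x) z))"
    if "w \<in> ?W" "z \<in> Z" for w j z
    using that by (simp add: split_coeffs_def)
  obtain d where d: "\<And>k z. z \<in> Z \<Longrightarrow> h z $ k = (\<Sum>w\<in>?W. d k w * word_prod w z)"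
    using h unfolding word_poly_def by metis
  have halves: "take D x \<in> ?W" "drop D x \<in> ?W" if "x \<in> words B (2 * D)" for x
    using that set_take_subset[of D x] set_drop_subset[of D x] by (auto simp: words_def)

  \<comment> \<open>The new right-hand side is polynomial, so the whole space can serve as its
    domain.\<close>
  define Y where "Y = topspace (Euclidean_space M)"
  define lift :: "state \<Rightarrow> state" where
    "lift z = (\<lambda>a. if a < M then word_prod (e a) z else 0)" for z
  \<comment> \<open>\<open>G\<close> has to reproduce the old dynamics only on the image of
    \<open>lift\<close>: the lifted old trajectories never leave it and already solve the new
    system.\<close>
  define G :: "state \<Rightarrow> nat \<Rightarrow> real ^ 'n" where
    "G s a = (\<chi> j. \<Sum>x\<in>words B (2 * D). c (e a) j x * (s (ix (take D x)) * s (ix (drop D x))))" for s a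
  define g :: "state \<Rightarrow> real ^ 'm" where "g s = (\<chi> k. \<Sum>a<M. d k (e a) * s a)" for s
  have lift_Y: "lift z \<in> Y" for z
    by (simp add: Y_def topspace_Euclidean_space lift_def)
  have lift_ix: "lift z (ix w) = word_prod w z" if "w \<in> ?W" for w z
    using ix[OF that] by (simp add: lift_def)
  have G_lift: "G (lift z) a = u (e a) z" if "a < M" "z \<in> Z" for a z
    using that c[OF eW] by (simp add: vec_eq_iff G_def lift_ix halves)
  have g_lift: "g (lift z) = h z" if "z \<in> Z" for z
  proof -
    have "(\<Sum>a<M. d k (e a) * word_prod (e a) z) = (\<Sum>w\<in>?W. d k w * word_prod w z)" for k
      by (rule sum.reindex_bij_betw[OF e])
    then show ?thesis using d[OF that] by (simp add: vec_eq_iff g_def lift_def)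
  qed
  have "\<exists>s. state_trajectory M Y G (lift z0) \<xi> s \<and> g (s 1) = \<phi> \<xi>" if \<xi>: "\<xi> \<in> X" for \<xi>
  proof -
    obtain z where z: "state_trajectory N Z F z0 \<xi> z" "h (z 1) = \<phi> \<xi>"
      using rep \<xi> unfolding FISCIDS_def by blast
    have zZ: "z \<tau> \<in> Z" if "\<tau> \<in> {0..1}" for \<tau>
      using z(1) that by (simp add: state_trajectory_def)
    have "((\<lambda>t. lift (z t) a) has_real_derivative (G (lift (z \<tau>)) a \<bullet> \<xi>)) (at \<tau> within {0..1})"
      if "\<tau> \<in> {0..1}" "a < M" for \<tau> a
      using u(2)[OF eW[OF that(2)]] z(1) that G_lift[OF that(2) zZ[OF that(1)]]
      by (simp add: has_lie_derivative_def lift_def)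
    then have "state_trajectory M Y G (lift z0) \<xi> (\<lambda>t. lift (z t))"
      using z(1) lift_Y by (simp add: state_trajectory_def)
    then show ?thesis using z(2) g_lift[OF zZ, of 1] by auto
  qed
  then have "FISCIDS X \<phi> M Y G g (lift z0)"
    unfolding FISCIDS_def using lift_Y by (simp add: Y_def)
  moreover have "poly_of_degree_le_on 2 M Y (\<lambda>s. G s a $ j)" for a j
    by (auto simp: G_def intro!: poly_of_degree_le_on_sum poly_of_degree_le_on_quadratic ix halves)
  \<comment> \<open>The constant term is 0, since a constant in the output is carried by the state
    of the empty word.\<close>
  moreover have "affine_fun_on M Y (\<lambda>s. g s $ k)" for k
    unfolding affine_fun_on_def by (intro exI[of _ "\<lambda>a. d k (e a)"] exI[of _ 0]) (simp add: g_def)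
  ultimately show ?thesis unfolding Q_FISCIDS_def by blast
qed

section \<open>Generators and degree bounds for a rational system\<close>

lemma ex_uniform_degree:
  assumes "finite B" "finite I" "\<And>i. i \<in> I \<Longrightarrow> \<exists>D. word_poly Z B D (f i)"
  shows "\<exists>D. \<forall>i\<in>I. word_poly Z B D (f i)"
proof -
  obtain d where d: "\<And>i. i \<in> I \<Longrightarrow> word_poly Z B (d i) (f i)"
    using assms(3) by metis
  have "d i \<le> Max (d ` I)" if "i \<in> I" for i
    using that assms(2) by simp
  then show ?thesis using d word_poly_mono[OF assms(1)] by blast
qed

lemma R_FISCIDS_imp_Q_FISCIDS:
  fixes F :: "state \<Rightarrow> nat \<Rightarrow> real ^ 'n" and h :: "state \<Rightarrow> real ^ 'm"
  assumes R: "R_FISCIDS X \<phi> N Z F h z0"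
  shows "\<exists>M Y G g y0. Q_FISCIDS X \<phi> M Y G g y0"
proof -
  have rep: "FISCIDS X \<phi> N Z F h z0"
    using R by (simp add: R_FISCIDS_def)
  \<comment> \<open>The condition \<open>i < N\<close> sits inside the existential so that choice
    yields total functions \<open>p\<close> and \<open>q\<close>.\<close>
  have "\<forall>i j. \<exists>p q. i < N \<longrightarrow> polynomial_on N Z p \<and> polynomial_on N Z q \<and>
      (\<forall>z\<in>Z. q z \<noteq> 0 \<and> F z i $ j = p z / q z)"
    using R by (auto simp: R_FISCIDS_def rational_on_def)
  then obtain p q where pq: "\<And>i j. i < N \<Longrightarrow> polynomial_on N Z (p i j)"
    "\<And>i j. i < N \<Longrightarrow> polynomial_on N Z (q i j)" "\<And>i j z. i < N \<Longrightarrow> z \<in> Z \<Longrightarrow> q i j z \<noteq> 0"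
    "\<And>i j z. i < N \<Longrightarrow> z \<in> Z \<Longrightarrow> F z i $ j = p i j z / q i j z"
    by metis
  have "\<forall>k. \<exists>p q. polynomial_on N Z p \<and> polynomial_on N Z q \<and>
      (\<forall>z\<in>Z. q z \<noteq> 0 \<and> h z $ k = p z / q z)"
    using R by (auto simp: R_FISCIDS_def rational_on_def)
  then obtain r s where rs: "\<And>k. polynomial_on N Z (r k)"
    "\<And>k. polynomial_on N Z (s k)" "\<And>k z. z \<in> Z \<Longrightarrow> s k z \<noteq> 0"
    "\<And>k z. z \<in> Z \<Longrightarrow> h z $ k = r k z / s k z"
    by metis
  \<comment> \<open>\<open>Q\<close> collects all denominators; it is finite because the index types
    of inputs and outputs are finite.\<close>
  define Q where "Q = (\<lambda>(i, j). q i j) ` ({..<N} \<times> UNIV) \<union> range s"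
  define B where "B = (\<lambda>i z. z i) ` {..<N} \<union> (\<lambda>f z. 1 / f z) ` Q"
  have fin: "finite B" by (simp add: B_def Q_def)
  have Q: "polynomial_on N Z f" "z \<in> Z \<Longrightarrow> f z \<noteq> 0" if "f \<in> Q" for f z
    using that pq rs by (auto simp: Q_def)
  have coord_in: "(\<lambda>z. z i) \<in> B" if "i < N" for i
    using that by (auto simp: B_def)
  have inv_in: "(\<lambda>z. 1 / f z) \<in> B" if "f \<in> Q" for f
    using that by (auto simp: B_def)
  have quot: "\<exists>D. word_poly Z B D f"
    if "polynomial_on N Z a" "b \<in> Q" "\<And>z. z \<in> Z \<Longrightarrow> f z = a z / b z" for a b f
  proof -
    have "\<exists>D. word_poly Z B D (\<lambda>z. a z * (1 / b z))"
      using ex_word_poly_mult[OF fin ex_word_poly_polynomial[OF fin coord_in that(1)]]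
        word_poly_generator[OF fin inv_in[OF that(2)]] by blast
    then obtain D where "word_poly Z B D (\<lambda>z. a z * (1 / b z))" by blast
    then have "word_poly Z B D f"
      by (rule word_poly_cong) (simp add: that(3))
    then show ?thesis by blast
  qed
  have F: "\<exists>D. word_poly Z B D (\<lambda>z. F z i $ j)" if "i < N" for i j
    by (rule quot[of "p i j" "q i j"]) (use pq that in \<open>auto simp: Q_def\<close>)
  have h: "\<exists>D. word_poly Z B D (\<lambda>z. h z $ k)" for k
    by (rule quot[of "r k" "s k"]) (use rs in \<open>auto simp: Q_def\<close>)
  \<comment> \<open>The derivative of a coordinate is a row of \<open>F\<close>, whose entries are
    polynomial in \<open>B\<close> although only rational in \<open>z\<close>.\<close>
  have coord: "poly_lie_derivative N Z F z0 B (\<lambda>z. z i)" if "i < N" for i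
  proof -
    have "\<exists>D. word_poly Z B D (\<lambda>z. z i)"
      by (rule exI[of _ 1]) (rule word_poly_generator[OF fin coord_in[OF that]])
    then show ?thesis
      unfolding poly_lie_derivative_def
      using F[OF that] has_lie_derivative_coord[OF that]
      by (intro conjI exI[of _ "\<lambda>z. F z i"] allI)
  qed
  \<comment> \<open>A denominator is a polynomial in the coordinates, so its own derivative is
    settled before that of its reciprocal.\<close>
  have "poly_lie_derivative N Z F z0 B (\<lambda>z. 1 / f z)" if "f \<in> Q" for f
    using poly_lie_derivative_inverse[OF fin poly_lie_derivative_polynomial[OF fin coord]] Q inv_in that
    by blast
  with coord have "\<forall>b\<in>B. poly_lie_derivative N Z F z0 B b"
    by (auto simp: B_def)
  then obtain v where v: "\<And>b j. b \<in> B \<Longrightarrow> \<exists>D. word_poly Z B D (\<lambda>z. v b z $ j)"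
    "\<And>b. b \<in> B \<Longrightarrow> has_lie_derivative N Z F z0 b (v b)"
    unfolding poly_lie_derivative_def by metis
  \<comment> \<open>There are finitely many pairs of a generator and an input component, so one
    degree bounds all these entries.\<close>
  have "\<exists>D. \<forall>i\<in>B \<times> UNIV. word_poly Z B D (\<lambda>z. v (fst i) z $ snd i)"
    using v(1) fin by (intro ex_uniform_degree) auto
  then obtain D1 where D1: "\<And>b j. b \<in> B \<Longrightarrow> word_poly Z B D1 (\<lambda>z. v b z $ j)" by auto
  have "\<exists>D. \<forall>k\<in>UNIV. word_poly Z B D (\<lambda>z. h z $ k)"
    using h fin by (intro ex_uniform_degree) auto
  then obtain D2 where D2: "\<And>k. word_poly Z B D2 (\<lambda>z. h z $ k)" by auto
  \<comment> \<open>The larger of the two bounds serves generator derivatives and output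
    simultaneously.\<close>
  show ?thesis
    by (rule Q_FISCIDS_of_words[OF rep fin v(2), where D = "max D1 D2"])
      (simp_all add: word_poly_mono[OF fin _ D1] word_poly_mono[OF fin _ D2])
qed

theorem theorem3:
  fixes X :: "(real ^ 'n) set" and \<phi> :: "real ^ 'n \<Rightarrow> real ^ 'm"
  assumes "open X"
    and "\<exists>N Z F h z0. R_FISCIDS X \<phi> N Z F h z0"
  shows "(\<exists>N Z F h z0. P_FISCIDS X \<phi> N Z F h z0) \<and>
         (\<exists>N Z F h z0. Q_FISCIDS X \<phi> N Z F h z0)"
  using assms(2) R_FISCIDS_imp_Q_FISCIDS Q_FISCIDS_imp_P_FISCIDS by meson

end
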